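(* Assume that for every nonempty set $A\subseteq\mathcal X\setminus\mathcal O$ there exists $x\in A$ such that $|\mathcal N_x\cap A|\le1$. Let $g\colon\mathcal O\to\mathbb R$ and let $u,v\colon\mathcal X\to\mathbb R$ satisfy $$u(x)\le H_1[u](x)\ \text{ for } x\in\mathcal X\setminus\mathcal O,\qquad u(x)\le g(x)\ \text{ for } x\in\mathcal O,$$ and $$v(x)\ge H_1[v](x)\ \text{ for } x\in\mathcal X\setminus\mathcal O,\qquad v(x)\ge g(x)\ \text{ for } x\in\mathcal O.$$ Then $u\le v$ in $\mathcal X$.
   Context: $\mathcal G=(\mathcal X,E)$ is a finite simple undirected graph, $\mathcal O\subseteq\mathcal X$ is the set of boundary vertices, and $\mathcal N_x$ is the set of neighbors of $x$. There is a fixed even integer $n\ge2$ with $|\mathcal N_x|=n$ for every $x\in\mathcal X\setminus\mathcal O$ (no degree condition on vertices of $\mathcal O$). For $u\colon\mathcal X\to\mathbb R$ and $x\in\mathcal X\setminus\mathcal O$, $$H_1[u](x)=\min_{\substack{y,z\in\mathcal N_x\\ y\ne z}}\frac{u(y)+u(z)}2.$$ *)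

theory Defs
  imports "Graph_Theory.Graph_Theory" Complex_Main
begin

(* A finite simple undirected graph is a pair_graph: a finite loop-free digraph whose arc set
   parcs G is symmetric, each edge being represented by its two orientations. *)

definition nbrs :: "'a pair_pre_digraph \<Rightarrow> 'a \<Rightarrow> 'a set" where
  "nbrs G x = {y. (x, y) \<in> parcs G}"

(* Meaningful when x has at least two and only finitely many neighbours; otherwise the set is
   empty or infinite and Min is unspecified. *)
definition H1 :: "'a pair_pre_digraph \<Rightarrow> ('a \<Rightarrow> real) \<Rightarrow> 'a \<Rightarrow> real" where
  "H1 G u x = Min {(u y + u z) / 2 | y z. y \<in> nbrs G x \<and> z \<in> nbrs G x \<and> y \<noteq> z}"

end

theory Submission
  imports Defs
begin

text \<open>
  At a vertex \<open>x\<close> where \<open>u - v\<close> attains a positive maximum \<open>m\<close>, take a pair \<open>y \<noteq> z\<close> realising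
  \<open>H1 G v x\<close>. Then \<open>u x \<le> (u y + u z) / 2 \<le> (v y + v z) / 2 + m \<le> v x + m = u x\<close>, so
  \<open>y\<close> and \<open>z\<close> are maximum points as well. Every vertex of the set of maximum points thus has two
  neighbours in that set, which the hypothesis on sets of interior vertices forbids.
\<close>

text \<open>Lets \<open>Min\<close> in \<open>H1\<close> be handled as a true minimum: the averages
  are indexed by pairs from a finite product.\<close>

lemma finite_neighbour_averages:
  assumes "finite (nbrs G x)"
  shows "finite {(u y + u z) / 2 | y z. y \<in> nbrs G x \<and> z \<in> nbrs G x \<and> y \<noteq> z}"
proof (rule finite_subset)
  show "{(u y + u z) / 2 | y z. y \<in> nbrs G x \<and> z \<in> nbrs G x \<and> y \<noteq> z}
    \<subseteq> (\<lambda>(y, z). (u y + u z) / 2) ` (nbrs G x \<times> nbrs G x)"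
    by auto
qed (use assms in simp)

lemma H1_le:
  assumes "finite (nbrs G x)" "y \<in> nbrs G x" "z \<in> nbrs G x" "y \<noteq> z"
  shows "H1 G u x \<le> (u y + u z) / 2"
  unfolding H1_def by (rule Min_le[OF finite_neighbour_averages]) (use assms in auto)

lemma H1_attained:
  assumes "card (nbrs G x) \<ge> 2"
  obtains y z where "y \<in> nbrs G x" "z \<in> nbrs G x" "y \<noteq> z" "H1 G u x = (u y + u z) / 2"
proof -
  let ?S = "{(u y + u z) / 2 | y z. y \<in> nbrs G x \<and> z \<in> nbrs G x \<and> y \<noteq> z}"
  \<comment> \<open>An infinite set has \<open>card\<close> 0, so the bound on \<open>card\<close>
    also gives finiteness.\<close>
  have "finite (nbrs G x)"
    using assms by (intro card_ge_0_finite) simp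
  moreover have "\<exists>y \<in> nbrs G x. \<exists>z \<in> nbrs G x. y \<noteq> z"
    using assms card_le_Suc0_iff_eq[OF \<open>finite (nbrs G x)\<close>] by force
  then have "?S \<noteq> {}"
    by blast
  ultimately have "Min ?S \<in> ?S"
    by (intro Min_in finite_neighbour_averages)
  then show thesis
    using that unfolding H1_def by blast
qed

theorem theorem5p2:
  fixes G :: "'a pair_pre_digraph"
    and \<O> :: "'a set"
    and n :: nat
    and g u v :: "'a \<Rightarrow> real"
  assumes "pair_graph G"
    and "\<O> \<subseteq> pverts G"
    and "even n" and "n \<ge> 2"
    and "\<forall>x \<in> pverts G - \<O>. card (nbrs G x) = n"
    and "\<forall>A. A \<noteq> {} \<and> A \<subseteq> pverts G - \<O> \<longrightarrow> (\<exists>x \<in> A. card (nbrs G x \<inter> A) \<le> 1)"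
    and "\<forall>x \<in> pverts G - \<O>. u x \<le> H1 G u x"
    and "\<forall>x \<in> \<O>. u x \<le> g x"
    and "\<forall>x \<in> pverts G - \<O>. v x \<ge> H1 G v x"
    and "\<forall>x \<in> \<O>. v x \<ge> g x"
  shows "\<forall>x \<in> pverts G. u x \<le> v x"
proof (rule ccontr)
  interpret pair_graph G by fact
  let ?I = "pverts G - \<O>"
  define m where "m = Max ((\<lambda>x. u x - v x) ` pverts G)"
  define M where "M = {x \<in> pverts G. u x - v x = m}"
  assume "\<not> (\<forall>x \<in> pverts G. u x \<le> v x)"
  then obtain a where a: "a \<in> pverts G" "u a > v a"
    by force
  have le_m: "u x - v x \<le> m" if "x \<in> pverts G" for x
    unfolding m_def using that by (intro Max_ge) auto
  have "m > 0"
    using le_m[OF a(1)] a(2) by simp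
  have "m \<in> (\<lambda>x. u x - v x) ` pverts G"
    unfolding m_def using a by (intro Max_in) auto
  then have "M \<noteq> {}"
    unfolding M_def by auto
  have "u x \<le> v x" if "x \<in> \<O>" for x
    using assms(8,10) that by (meson order_trans)
  \<comment> \<open>On the boundary \<open>u - v\<close> is at most 0, hence below
    \<open>m\<close>.\<close>
  then have "M \<subseteq> ?I"
    using \<open>m > 0\<close> unfolding M_def by force
  with \<open>M \<noteq> {}\<close> obtain x where x: "x \<in> M" "card (nbrs G x \<inter> M) \<le> 1"
    using assms(6) by blast
  then have "x \<in> ?I" and ux: "u x - v x = m"
    using \<open>M \<subseteq> ?I\<close> unfolding M_def by auto
  then have card: "card (nbrs G x) \<ge> 2"
    using assms(4,5) by simp
  then have fin: "finite (nbrs G x)"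
    by (intro card_ge_0_finite) simp
  obtain y z where yz: "y \<in> nbrs G x" "z \<in> nbrs G x" "y \<noteq> z"
    and Hv: "H1 G v x = (v y + v z) / 2"
    using H1_attained[OF card] .
  have verts: "y \<in> pverts G" "z \<in> pverts G"
    using yz in_arcsD2 unfolding nbrs_def by auto
  \<comment> \<open>The pair is optimal for \<open>v\<close>; for \<open>u\<close> it is merely one
    competitor in the minimum.\<close>
  have "u x \<le> (u y + u z) / 2"
    using assms(7) \<open>x \<in> ?I\<close> H1_le[OF fin yz, of u] by force
  moreover have "(v y + v z) / 2 \<le> v x"
    using assms(9) \<open>x \<in> ?I\<close> Hv by force
  \<comment> \<open>The values of \<open>u - v\<close> at \<open>y\<close> and \<open>z\<close>
    average to at least \<open>m\<close>, and neither exceeds \<open>m\<close>, so both equal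
    \<open>m\<close>.\<close>
  ultimately have "u y - v y = m" "u z - v z = m"
    using ux le_m[OF verts(1)] le_m[OF verts(2)] by (simp_all add: field_simps)
  then have "{y, z} \<subseteq> nbrs G x \<inter> M"
    using yz verts unfolding M_def by auto
  then have "card {y, z} \<le> card (nbrs G x \<inter> M)"
    using fin by (intro card_mono) auto
  then show False
    using x(2) \<open>y \<noteq> z\<close> by simp
qed

end
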